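(* For any $a, b \in \mathbb{N}$, the reflective Ramsey number of the alternating path $P^{\mathrm{alt}}_a$ versus the monotone path $P^{\mathrm{mon}}_b$ satisfies $$R_{\mathrm{ref}}(P^{\mathrm{alt}}_a, P^{\mathrm{mon}}_b) = 1 + (a-1)(b-1).$$
   Context: $\mathbb{N}=\{1,2,3,\ldots\}$. All graphs are undirected, simple and finite, with vertex set $\{0,1,\ldots,n-1\}$ for some $n\in\mathbb{N}$; $|G|$ denotes the order of $G$. $K_n$ is the complete graph on $n$ vertices. A $k$-edge-coloring of a graph is a map from its edge set to $\{1,\ldots,k\}$. For graphs $G,H$ and a permutation group $\Gamma$ on $V(H)$, $H$ is $\Gamma$-embeddable in $G$ if there is a graph homomorphism from $H$ to $G$ of the form $\psi\circ\varphi$, where $\varphi\in\Gamma$ and $\psi\colon V(H)\to V(G)$ is an increasing injection. For graphs $H_1,\ldots,H_k$ and permutation groups $\Gamma_1,\ldots,\Gamma_k$ on their respective vertex sets, the permutational Ramsey number $R(H_1^{\Gamma_1},\ldots,H_k^{\Gamma_k})$ is the minimum $n\in\mathbb{N}$ such that for every $k$-edge-coloring of $K_n$ there is some $j$ for which $H_j$ is $\Gamma_j$-embeddable in the spanning subgraph of $K_n$ comprising the edges of color $j$. The reflective Ramsey number $R_{\mathrm{ref}}(H_1,\ldots,H_k)$ is the permutational Ramsey number in which each $\Gamma_j$ is the group generated by the reflection $x\mapsto |H_j|-1-x$ of $V(H_j)$. For $n\in\mathbb{N}$, the monotone path $P^{\mathrm{mon}}_n$ is the graph of order $n$ in which two vertices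 are adjacent if and only if they are consecutive integers; the alternating path $P^{\mathrm{alt}}_n$ is the path graph of order $n$ whose underlying path is $(0, n-1, 1, n-2, 2, n-3, \ldots, \lfloor n/2\rfloor)$. *)

theory Defs
  imports "HOL-Algebra.Bij" "HOL-Algebra.Generated_Groups"
begin

text \<open>
  The vertex set of a graph of order \<open>n\<close> is \<open>{..<n}\<close>, so a graph is given by its order and its
  edges, each edge being a set of two vertices.  The vertex labels, and not only the isomorphism
  class, matter throughout.
\<close>

record ordered_graph =
  order_of :: nat
  edges :: "nat set set"

abbreviation vertices :: "ordered_graph \<Rightarrow> nat set" where
  "vertices G \<equiv> {..<order_of G}"

definition two_subsets :: "nat \<Rightarrow> nat set set" where
  "two_subsets n = {e. e \<subseteq> {..<n} \<and> card e = 2}"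

definition simple_graph :: "ordered_graph \<Rightarrow> bool" where
  "simple_graph G \<longleftrightarrow> order_of G \<ge> 1 \<and> edges G \<subseteq> two_subsets (order_of G)"

definition complete_graph :: "nat \<Rightarrow> ordered_graph" where
  "complete_graph n = \<lparr>order_of = n, edges = two_subsets n\<rparr>"

definition graph_hom :: "ordered_graph \<Rightarrow> ordered_graph \<Rightarrow> (nat \<Rightarrow> nat) \<Rightarrow> bool" where
  "graph_hom H G f \<longleftrightarrow>
     f \<in> vertices H \<rightarrow> vertices G \<and> (\<forall>e\<in>edges H. f ` e \<in> edges G)"

text \<open>
  Permutation groups on \<open>V(H)\<close> are subgroups of \<open>BijGroup (vertices H)\<close>; their elements are
  therefore extensional, i.e. \<open>undefined\<close> outside \<open>V(H)\<close>.  This is harmless here because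
  \<open>graph_hom\<close> only looks at values on \<open>V(H)\<close>.
\<close>

definition embeddable :: "ordered_graph \<Rightarrow> (nat \<Rightarrow> nat) set \<Rightarrow> ordered_graph \<Rightarrow> bool" where
  "embeddable H \<Gamma> G \<longleftrightarrow>
     (\<exists>\<phi>\<in>\<Gamma>. \<exists>\<psi>. \<psi> \<in> vertices H \<rightarrow> vertices G \<and> strict_mono_on (vertices H) \<psi>
        \<and> graph_hom H G (\<psi> \<circ> \<phi>))"

definition edge_coloring :: "nat \<Rightarrow> ordered_graph \<Rightarrow> (nat set \<Rightarrow> nat) \<Rightarrow> bool" where
  "edge_coloring k G c \<longleftrightarrow> c \<in> edges G \<rightarrow> {1..k}"

definition color_subgraph :: "ordered_graph \<Rightarrow> (nat set \<Rightarrow> nat) \<Rightarrow> nat \<Rightarrow> ordered_graph" where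
  "color_subgraph G c j = \<lparr>order_of = order_of G, edges = {e \<in> edges G. c e = j}\<rparr>"

text \<open>
  The list \<open>[(H\<^sub>1, \<Gamma>\<^sub>1), \<dots>, (H\<^sub>k, \<Gamma>\<^sub>k)]\<close> is indexed from 0, the colors from 1.
\<close>

definition perm_ramsey_prop :: "(ordered_graph \<times> (nat \<Rightarrow> nat) set) list \<Rightarrow> nat \<Rightarrow> bool" where
  "perm_ramsey_prop Hs n \<longleftrightarrow>
     (\<forall>c. edge_coloring (length Hs) (complete_graph n) c \<longrightarrow>
        (\<exists>j\<in>{1..length Hs}.
           embeddable (fst (Hs ! (j - 1))) (snd (Hs ! (j - 1)))
             (color_subgraph (complete_graph n) c j)))"

definition perm_ramsey :: "(ordered_graph \<times> (nat \<Rightarrow> nat) set) list \<Rightarrow> nat" where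
  "perm_ramsey Hs = (LEAST n. n \<ge> 1 \<and> perm_ramsey_prop Hs n)"

definition reflection :: "ordered_graph \<Rightarrow> nat \<Rightarrow> nat" where
  "reflection H = (\<lambda>x\<in>vertices H. order_of H - 1 - x)"

definition reflection_group :: "ordered_graph \<Rightarrow> (nat \<Rightarrow> nat) set" where
  "reflection_group H = generate (BijGroup (vertices H)) {reflection H}"

definition reflective_ramsey :: "ordered_graph list \<Rightarrow> nat" where
  "reflective_ramsey Hs = perm_ramsey (map (\<lambda>H. (H, reflection_group H)) Hs)"

definition mon_path :: "nat \<Rightarrow> ordered_graph" where
  "mon_path n = \<lparr>order_of = n, edges = {{i, Suc i} | i. Suc i < n}\<rparr>"

text \<open>
  \<open>alt_vertex n i\<close> is the entry at position \<open>i\<close> (from 0) of the sequence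
  \<open>0, n - 1, 1, n - 2, 2, n - 3, \<dots>\<close>.
\<close>

definition alt_vertex :: "nat \<Rightarrow> nat \<Rightarrow> nat" where
  "alt_vertex n i = (if even i then i div 2 else n - 1 - i div 2)"

definition alt_path :: "nat \<Rightarrow> ordered_graph" where
  "alt_path n = \<lparr>order_of = n, edges = {{alt_vertex n i, alt_vertex n (Suc i)} | i. Suc i < n}\<rparr>"

lemma alt_vertex_last: "n \<ge> 1 \<Longrightarrow> alt_vertex n (n - 1) = n div 2"
  unfolding alt_vertex_def by (cases "even n") (auto elim!: evenE oddE)

lemma alt_vertex_bij: "bij_betw (alt_vertex n) {..<n} {..<n}"
proof -
  have "alt_vertex n ` {..<n} \<subseteq> {..<n}"
    by (auto simp: alt_vertex_def)
  moreover have "inj_on (alt_vertex n) {..<n}"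
    by (rule inj_onI) (auto simp: alt_vertex_def elim!: evenE oddE split: if_splits)
  ultimately show ?thesis
    by (simp add: bij_betw_def endo_inj_surj)
qed

lemma simple_graph_complete_graph: "n \<ge> 1 \<Longrightarrow> simple_graph (complete_graph n)"
  by (simp add: simple_graph_def complete_graph_def)

lemma simple_graph_color_subgraph: "simple_graph G \<Longrightarrow> simple_graph (color_subgraph G c j)"
  by (auto simp: simple_graph_def color_subgraph_def)

lemma simple_graph_mon_path: "n \<ge> 1 \<Longrightarrow> simple_graph (mon_path n)"
  by (auto simp: simple_graph_def mon_path_def two_subsets_def)

lemma simple_graph_alt_path:
  assumes "n \<ge> 1"
  shows "simple_graph (alt_path n)"
proof -
  have "{alt_vertex n i, alt_vertex n (Suc i)} \<in> two_subsets n" if "Suc i < n" for i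
  proof -
    have "alt_vertex n i < n" "alt_vertex n (Suc i) < n"
      using that by (auto simp: alt_vertex_def)
    moreover have "alt_vertex n i \<noteq> alt_vertex n (Suc i)"
      using inj_onD[OF bij_betw_imp_inj_on[OF alt_vertex_bij[of n]], of i "Suc i"] that by auto
    ultimately show ?thesis
      by (auto simp: two_subsets_def)
  qed
  then show ?thesis
    using assms by (auto simp: simple_graph_def alt_path_def)
qed

lemma reflection_Bij: "reflection H \<in> Bij (vertices H)"
proof -
  have "bij_betw (reflection H) (vertices H) (vertices H)"
    by (rule bij_betwI[where g = "reflection H"]) (auto simp: reflection_def)
  then show ?thesis
    by (auto simp: Bij_def reflection_def)
qed

lemma reflection_group_subgroup: "subgroup (reflection_group H) (BijGroup (vertices H))"
  unfolding reflection_group_def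
  using reflection_Bij[of H]
  by (intro group.generate_is_subgroup group_BijGroup) (simp add: BijGroup_def)

end

theory Submission
  imports Defs "HOL-Library.Infinite_Set"
begin

text \<open>
  The proof rests on two features of the graphs: an alternating path is a connected graph of order \<open>a\<close>,
  and a monotone path is mapped to itself by the reflection.

  For the upper bound, a set of more than \<open>(a - 1) * (b - 1)\<close> naturals contains, by an argument in
  the style of Mirsky's theorem (\<open>independent_set_or_increasing_chain\<close>), either an increasing chain
  of \<open>b\<close> elements whose consecutive pairs have color 2, or \<open>a\<close> elements spanning only color 1.
  The first is a monotone path in color 2.  The second is a clique of order \<open>a\<close> in color 1, and any
  graph of order \<open>a\<close> is embedded in it by listing the clique in increasing order
  (\<open>embeddable_in_clique\<close>).

  For the lower bound, cut \<open>n \<le> (a - 1) * (b - 1)\<close> vertices into at most \<open>b - 1\<close> consecutive blocks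
  of at most \<open>a - 1\<close> vertices, and give color 1 exactly to the edges inside a block.  A connected
  graph in color 1 stays inside one block, so an alternating path does not fit there
  (\<open>no_alt_path_within_blocks\<close>); a monotone path in color 2 enters a new block at every step, so it
  runs out of blocks (\<open>no_mon_path_across_blocks\<close>).
\<close>

section \<open>Embeddings under the reflection group\<close>

lemma one_in_reflection_group: "(\<lambda>x\<in>vertices H. x) \<in> reflection_group H"
  using subgroup.one_closed[OF reflection_group_subgroup[of H]] by (simp add: BijGroup_def)

lemma reflection_group_bij:
  assumes "\<phi> \<in> reflection_group H"
  shows "bij_betw \<phi> (vertices H) (vertices H)"
  using subgroup.subset[OF reflection_group_subgroup[of H]] assms
  by (auto simp: BijGroup_def Bij_def)

lemma reflection_group_cases:
  assumes "\<phi> \<in> reflection_group H"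
  shows "(\<forall>x\<in>vertices H. \<phi> x = x) \<or> (\<forall>x\<in>vertices H. \<phi> x = order_of H - 1 - x)"
proof -
  interpret group "BijGroup (vertices H)" by (rule group_BijGroup)
  have carr: "reflection H \<in> carrier (BijGroup (vertices H))"
    using reflection_Bij by (simp add: BijGroup_def)
  have involution: "reflection H \<otimes>\<^bsub>BijGroup (vertices H)\<^esub> reflection H = \<one>\<^bsub>BijGroup (vertices H)\<^esub>"
  proof -
    have "compose (vertices H) (reflection H) (reflection H) = (\<lambda>x\<in>vertices H. x)"
      by (rule ext) (auto simp: compose_def reflection_def)
    then show ?thesis by (simp add: BijGroup_def reflection_Bij)
  qed
  have self_inverse: "inv\<^bsub>BijGroup (vertices H)\<^esub> (reflection H) = reflection H"
    using inv_equality[OF involution carr carr] .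
  have "\<phi> = \<one>\<^bsub>BijGroup (vertices H)\<^esub> \<or> \<phi> = reflection H"
    using assms unfolding reflection_group_def
  proof (induction rule: generate.induct)
    case (eng h1 h2)
    then show ?case using carr involution by auto
  qed (use self_inverse in auto)
  then show ?thesis
    by (auto simp: BijGroup_def reflection_def)
qed

text \<open>
  The reflection is an automorphism of the monotone path: after reflecting, the edge at position
  \<open>b - 2 - i\<close> takes the place of the edge at position \<open>i\<close>.
\<close>

lemma embeddable_mon_path_iff:
  "embeddable (mon_path b) (reflection_group (mon_path b)) G \<longleftrightarrow>
     (\<exists>\<psi>. \<psi> \<in> {..<b} \<rightarrow> vertices G \<and> strict_mono_on {..<b} \<psi>
        \<and> (\<forall>i. Suc i < b \<longrightarrow> {\<psi> i, \<psi> (Suc i)} \<in> edges G))" (is "?L \<longleftrightarrow> ?R")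
proof
  assume ?L
  then obtain \<phi> \<psi> where \<phi>: "\<phi> \<in> reflection_group (mon_path b)"
    and \<psi>: "\<psi> \<in> {..<b} \<rightarrow> vertices G" "strict_mono_on {..<b} \<psi>"
    and hom: "graph_hom (mon_path b) G (\<psi> \<circ> \<phi>)"
    by (auto simp: embeddable_def mon_path_def)
  have hom_edge: "{\<psi> (\<phi> i), \<psi> (\<phi> (Suc i))} \<in> edges G" if "Suc i < b" for i
  proof -
    have "{i, Suc i} \<in> edges (mon_path b)"
      using that by (auto simp: mon_path_def)
    then have "(\<psi> \<circ> \<phi>) ` {i, Suc i} \<in> edges G"
      using hom unfolding graph_hom_def by blast
    then show ?thesis by simp
  qed
  have "{\<psi> i, \<psi> (Suc i)} \<in> edges G" if i: "Suc i < b" for i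
    using reflection_group_cases[OF \<phi>]
  proof
    assume "\<forall>x\<in>vertices (mon_path b). \<phi> x = x"
    then show ?thesis using hom_edge[OF i] i by (simp add: mon_path_def)
  next
    assume refl: "\<forall>x\<in>vertices (mon_path b). \<phi> x = order_of (mon_path b) - 1 - x"
    define j where "j = b - 2 - i"
    have j: "Suc j < b" "b - 1 - j = Suc i" "b - 1 - Suc j = i"
      using i by (auto simp: j_def)
    have "\<phi> j = Suc i" "\<phi> (Suc j) = i"
      using refl j by (auto simp: mon_path_def)
    then show ?thesis using hom_edge[OF j(1)] by (simp add: insert_commute)
  qed
  then show ?R using \<psi> by blast
next
  assume ?R
  then obtain \<psi> where \<psi>: "\<psi> \<in> {..<b} \<rightarrow> vertices G" "strict_mono_on {..<b} \<psi>"
    and path: "\<And>i. Suc i < b \<Longrightarrow> {\<psi> i, \<psi> (Suc i)} \<in> edges G"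
    by blast
  have "graph_hom (mon_path b) G (\<psi> \<circ> (\<lambda>x\<in>vertices (mon_path b). x))"
    using \<psi>(1) path by (auto simp: graph_hom_def mon_path_def)
  then show ?L
    unfolding embeddable_def using one_in_reflection_group[of "mon_path b"] \<psi>
    by (intro bexI[of _ "\<lambda>x\<in>vertices (mon_path b). x"] exI[of _ \<psi>]) (auto simp: mon_path_def)
qed

lemma embeddable_in_clique:
  assumes H: "simple_graph H"
    and T: "finite T" "card T = order_of H" "T \<subseteq> vertices G"
    and clique: "\<And>x y. x \<in> T \<Longrightarrow> y \<in> T \<Longrightarrow> x < y \<Longrightarrow> {x, y} \<in> edges G"
  shows "embeddable H (reflection_group H) G"
proof -
  obtain \<psi> where mono: "strict_mono_on (vertices H) \<psi>" and in_T: "\<And>i. i < order_of H \<Longrightarrow> \<psi> i \<in> T"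
    using finite_enumerate[OF T(1)] T(2) by auto
  have "(\<psi> \<circ> (\<lambda>x\<in>vertices H. x)) ` e \<in> edges G" if "e \<in> edges H" for e
  proof -
    have "e \<in> two_subsets (order_of H)"
      using H that by (auto simp: simple_graph_def)
    then have "e \<subseteq> vertices H" "card e = 2"
      by (auto simp: two_subsets_def)
    then obtain x y where e: "e = {x, y}" "x < y" "x < order_of H" "y < order_of H"
      by (metis card_2_iff insert_commute insert_subset lessThan_iff linorder_neqE_nat)
    then have "\<psi> x < \<psi> y"
      using mono by (auto simp: strict_mono_on_def)
    then show ?thesis using clique e in_T by auto
  qed
  moreover have "\<psi> \<in> vertices H \<rightarrow> vertices G"
    using in_T T(3) by auto
  ultimately show ?thesis
    unfolding embeddable_def graph_hom_def
    using one_in_reflection_group[of H] mono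
    by (intro bexI[of _ "\<lambda>x\<in>vertices H. x"] exI[of _ \<psi>]) auto
qed

section \<open>The upper bound\<close>

lemma strict_mono_on_lessThanI:
  fixes \<psi> :: "nat \<Rightarrow> nat"
  assumes "\<And>i. Suc i < b \<Longrightarrow> \<psi> i < \<psi> (Suc i)"
  shows "strict_mono_on {..<b} \<psi>"
proof (rule strict_mono_onI)
  fix i j assume "i \<in> {..<b}" "j \<in> {..<b}" "i < j"
  then have "Suc i \<le> j" "j < b" by auto
  then show "\<psi> i < \<psi> j"
  proof (induction j rule: dec_induct)
    case base
    then show ?case using assms[of i] by simp
  next
    case (step j)
    then show ?case using assms[of j] by simp
  qed
qed

text \<open>
  Induction on the length of the chain.  The elements of \<open>S\<close> without a smaller
  \<open>E\<close>-predecessor in \<open>S\<close> are pairwise unrelated.  If there are only \<open>m\<close> of them, delete them: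
  every remaining element has a predecessor in \<open>S\<close>, so a chain among the remaining elements can be
  prolonged by one element at its start.
\<close>

lemma independent_set_or_increasing_chain:
  fixes S :: "nat set" and E :: "nat \<Rightarrow> nat \<Rightarrow> bool"
  assumes "finite S" and "card S > m * k"
  shows "(\<exists>T\<subseteq>S. card T = Suc m \<and> (\<forall>x\<in>T. \<forall>y\<in>T. x < y \<longrightarrow> \<not> E x y)) \<or>
    (\<exists>\<psi>. (\<forall>i\<le>k. \<psi> i \<in> S) \<and> (\<forall>i<k. \<psi> i < \<psi> (Suc i) \<and> E (\<psi> i) (\<psi> (Suc i))))"
  using assms
proof (induction k arbitrary: S)
  case 0
  then obtain x where "x \<in> S" by fastforce
  then show ?case by (intro disjI2 exI[of _ "\<lambda>_. x"]) simp
next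
  case (Suc k)
  define T where "T = {x\<in>S. \<forall>y\<in>S. y < x \<longrightarrow> \<not> E y x}"
  have T: "T \<subseteq> S" "finite T" and T_indep: "\<forall>x\<in>T. \<forall>y\<in>T. x < y \<longrightarrow> \<not> E x y"
    using Suc.prems(1) by (auto simp: T_def)
  show ?case
  proof (cases "Suc m \<le> card T")
    case True
    then obtain T' where "T' \<subseteq> T" "card T' = Suc m"
      by (meson obtain_subset_with_card_n)
    then have "T' \<subseteq> S" "\<forall>x\<in>T'. \<forall>y\<in>T'. x < y \<longrightarrow> \<not> E x y"
      using T(1) T_indep by (auto dest: subsetD)
    then show ?thesis using \<open>card T' = Suc m\<close> by (intro disjI1 exI[of _ T'] conjI)
  next
    case False
    have "card (S - T) = card S - card T"
      using T by (simp add: card_Diff_subset)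
    then have "card (S - T) > m * k"
      using False Suc.prems(2) by simp
    with Suc.IH[of "S - T"] Suc.prems(1) have
      "(\<exists>T'\<subseteq>S - T. card T' = Suc m \<and> (\<forall>x\<in>T'. \<forall>y\<in>T'. x < y \<longrightarrow> \<not> E x y)) \<or>
       (\<exists>\<psi>. (\<forall>i\<le>k. \<psi> i \<in> S - T) \<and> (\<forall>i<k. \<psi> i < \<psi> (Suc i) \<and> E (\<psi> i) (\<psi> (Suc i))))"
      by simp
    then show ?thesis
    proof (elim disjE exE conjE)
      fix T' assume "T' \<subseteq> S - T" "card T' = Suc m" "\<forall>x\<in>T'. \<forall>y\<in>T'. x < y \<longrightarrow> \<not> E x y"
      then show ?thesis by (intro disjI1 exI[of _ T'] conjI) auto
    next
      fix \<psi> assume chain: "\<forall>i\<le>k. \<psi> i \<in> S - T" "\<forall>i<k. \<psi> i < \<psi> (Suc i) \<and> E (\<psi> i) (\<psi> (Suc i))"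
      then have "\<psi> 0 \<in> S - T" by simp
      then obtain y where y: "y \<in> S" "y < \<psi> 0" "E y (\<psi> 0)"
        by (auto simp: T_def)
      let ?\<chi> = "case_nat y \<psi>"
      have "\<forall>i\<le>Suc k. ?\<chi> i \<in> S" "\<forall>i<Suc k. ?\<chi> i < ?\<chi> (Suc i) \<and> E (?\<chi> i) (?\<chi> (Suc i))"
        using chain y by (auto split: nat.split)
      then show ?thesis by (intro disjI2 exI[of _ ?\<chi>] conjI)
    qed
  qed
qed

lemma graph_versus_mon_path_upper:
  assumes H: "simple_graph H" and b: "b \<ge> 1" and n: "n > (order_of H - 1) * (b - 1)"
  shows "perm_ramsey_prop
    [(H, reflection_group H), (mon_path b, reflection_group (mon_path b))] n"
  unfolding perm_ramsey_prop_def
proof (intro allI impI)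
  let ?Hs = "[(H, reflection_group H), (mon_path b, reflection_group (mon_path b))]"
  fix c assume "edge_coloring (length ?Hs) (complete_graph n) c"
  then have c: "c e = 1 \<or> c e = 2" if "e \<in> two_subsets n" for e
    using that by (fastforce simp: edge_coloring_def complete_graph_def Pi_iff)
  let ?G = "\<lambda>j. color_subgraph (complete_graph n) c j"
  have color_edge: "{x, y} \<in> edges (?G j)" if "x < y" "y < n" "c {x, y} = j" for x y j
    using that by (auto simp: color_subgraph_def complete_graph_def two_subsets_def)
  have vert: "vertices (?G j) = {..<n}" for j
    by (simp add: color_subgraph_def complete_graph_def)
  from independent_set_or_increasing_chain[of "{..<n}" "order_of H - 1" "b - 1" "\<lambda>x y. c {x, y} = 2"] n
  consider (clique) T where "T \<subseteq> {..<n}" "card T = Suc (order_of H - 1)"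
        "\<forall>x\<in>T. \<forall>y\<in>T. x < y \<longrightarrow> c {x, y} \<noteq> 2"
    | (chain) \<psi> where "\<forall>i\<le>b - 1. \<psi> i \<in> {..<n}"
        "\<forall>i<b - 1. \<psi> i < \<psi> (Suc i) \<and> c {\<psi> i, \<psi> (Suc i)} = 2"
    by auto
  then show "\<exists>j\<in>{1..length ?Hs}. embeddable (fst (?Hs ! (j - 1))) (snd (?Hs ! (j - 1))) (?G j)"
  proof cases
    case clique
    have "embeddable H (reflection_group H) (?G 1)"
    proof (rule embeddable_in_clique[OF H, of T])
      show "finite T" using clique(1) finite_subset by blast
      show "card T = order_of H" using clique(2) H by (simp add: simple_graph_def)
      show "T \<subseteq> vertices (?G 1)" using clique(1) vert by simp
      fix x y assume xy: "x \<in> T" "y \<in> T" "x < y"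
      then have "y < n" using clique(1) by blast
      then have "c {x, y} = 1"
        using clique(3) c[of "{x, y}"] xy by (auto simp: two_subsets_def)
      then show "{x, y} \<in> edges (?G 1)" by (rule color_edge[OF \<open>x < y\<close> \<open>y < n\<close>])
    qed
    then show ?thesis by (intro bexI[of _ 1]) auto
  next
    case chain
    have "strict_mono_on {..<b} \<psi>"
      by (rule strict_mono_on_lessThanI) (use chain(2) in auto)
    moreover have "\<forall>i. Suc i < b \<longrightarrow> {\<psi> i, \<psi> (Suc i)} \<in> edges (?G 2)"
      using chain by (intro allI impI color_edge) auto
    moreover have "\<psi> \<in> {..<b} \<rightarrow> vertices (?G 2)"
      using chain(1) b vert by auto
    ultimately have "embeddable (mon_path b) (reflection_group (mon_path b)) (?G 2)"
      unfolding embeddable_mon_path_iff by blast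
    then show ?thesis by (intro bexI[of _ 2]) auto
  qed
qed

section \<open>The lower bound\<close>

text \<open>
  Walking along the path never leaves the block of its first vertex, and the \<open>Suc m\<close> distinct images do not fit into one block.
\<close>

lemma no_alt_path_within_blocks:
  assumes m: "m > 0" and same_block: "\<And>x y. {x, y} \<in> edges G \<Longrightarrow> x div m = y div m"
  shows "\<not> embeddable (alt_path (Suc m)) (reflection_group (alt_path (Suc m))) G"
proof
  let ?H = "alt_path (Suc m)"
  have vert: "vertices ?H = {..<Suc m}" by (simp add: alt_path_def)
  assume "embeddable ?H (reflection_group ?H) G"
  then obtain \<phi> \<psi> where \<phi>: "\<phi> \<in> reflection_group ?H" and \<psi>: "strict_mono_on (vertices ?H) \<psi>"
    and hom: "graph_hom ?H G (\<psi> \<circ> \<phi>)"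
    by (auto simp: embeddable_def)
  define f where "f = \<psi> \<circ> \<phi> \<circ> alt_vertex (Suc m)"
  have "inj_on (\<psi> \<circ> \<phi>) (vertices ?H)"
    using reflection_group_bij[OF \<phi>] strict_mono_on_imp_inj_on[OF \<psi>]
    by (simp add: bij_betw_def comp_inj_on)
  then have inj: "inj_on f {..<Suc m}"
    unfolding f_def using alt_vertex_bij[of "Suc m"] vert
    by (simp add: bij_betw_def comp_inj_on)
  have step: "f i div m = f (Suc i) div m" if "Suc i < Suc m" for i
  proof -
    have "{alt_vertex (Suc m) i, alt_vertex (Suc m) (Suc i)} \<in> edges ?H"
      using that by (auto simp: alt_path_def)
    then have "(\<psi> \<circ> \<phi>) ` {alt_vertex (Suc m) i, alt_vertex (Suc m) (Suc i)} \<in> edges G"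
      using hom unfolding graph_hom_def by blast
    then show ?thesis by (intro same_block) (simp add: f_def)
  qed
  have block: "f i div m = f 0 div m" if "i < Suc m" for i
    using that by (induction i) (use step in auto)
  define q where "q = f 0 div m"
  have "f ` {..<Suc m} \<subseteq> {q * m ..< q * m + m}"
  proof (rule image_subsetI)
    fix i assume "i \<in> {..<Suc m}"
    then have "f i div m = q" using block[of i] by (simp only: q_def lessThan_iff)
    then show "f i \<in> {q * m ..< q * m + m}"
      using div_mult_mod_eq[of "f i" m] mod_less_divisor[OF m, of "f i"] by auto
  qed
  then have "card (f ` {..<Suc m}) \<le> m"
    using card_mono[of "{q * m ..< q * m + m}"] by simp
  then show False using card_image[OF inj] by simp
qed

text \<open>
  The block number cannot decrease along an increasing path and changes at every step, so the
  vertex at position \<open>i\<close> lies in block \<open>i\<close> or later; the blocks are numbered below \<open>k\<close>.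
\<close>

lemma no_mon_path_across_blocks:
  assumes n: "n \<le> m * k" and vert: "vertices G \<subseteq> {..<n}"
    and different_blocks: "\<And>x y. {x, y} \<in> edges G \<Longrightarrow> x div m \<noteq> y div m"
  shows "\<not> embeddable (mon_path (Suc k)) (reflection_group (mon_path (Suc k))) G"
proof
  assume "embeddable (mon_path (Suc k)) (reflection_group (mon_path (Suc k))) G"
  then obtain \<psi> where \<psi>: "\<psi> \<in> {..<Suc k} \<rightarrow> vertices G" "strict_mono_on {..<Suc k} \<psi>"
    and path: "\<And>i. Suc i < Suc k \<Longrightarrow> {\<psi> i, \<psi> (Suc i)} \<in> edges G"
    unfolding embeddable_mon_path_iff by blast
  have "i \<le> \<psi> i div m" if "i < Suc k" for i
    using that
  proof (induction i)
    case (Suc i)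
    have "\<psi> i < \<psi> (Suc i)"
      using \<psi>(2) Suc.prems by (auto simp: strict_mono_on_def)
    then have "\<psi> i div m \<le> \<psi> (Suc i) div m"
      by (intro div_le_mono) simp
    then show ?case
      using Suc different_blocks[OF path[OF Suc.prems]] by simp
  qed simp
  then have "k \<le> \<psi> k div m" by simp
  moreover have "\<psi> k \<in> vertices G"
    using \<psi>(1) by (rule funcset_mem) simp
  then have "\<psi> k < n"
    using vert by auto
  then have "\<psi> k < k * m"
    using n by (simp add: mult.commute)
  then have "\<psi> k div m < k"
    by (rule less_mult_imp_div_less)
  ultimately show False by simp
qed

lemma alt_path_versus_mon_path_lower:
  assumes m: "m > 0" and n: "n \<le> m * k"
  shows "\<not> perm_ramsey_prop
    [(alt_path (Suc m), reflection_group (alt_path (Suc m))),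
     (mon_path (Suc k), reflection_group (mon_path (Suc k)))] n"
proof
  let ?Hs = "[(alt_path (Suc m), reflection_group (alt_path (Suc m))),
     (mon_path (Suc k), reflection_group (mon_path (Suc k)))]"
  define c :: "nat set \<Rightarrow> nat" where "c e = (if \<forall>x\<in>e. \<forall>y\<in>e. x div m = y div m then 1 else 2)" for e
  let ?G = "\<lambda>j. color_subgraph (complete_graph n) c j"
  assume "perm_ramsey_prop ?Hs n"
  moreover have "edge_coloring (length ?Hs) (complete_graph n) c"
    by (auto simp: edge_coloring_def c_def)
  ultimately obtain j where "j \<in> {1..length ?Hs}"
    and emb: "embeddable (fst (?Hs ! (j - 1))) (snd (?Hs ! (j - 1))) (?G j)"
    unfolding perm_ramsey_prop_def by blast
  then consider "j = 1" | "j = 2" by fastforce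
  then show False
  proof cases
    case 1
    moreover have "x div m = y div m" if "{x, y} \<in> edges (?G 1)" for x y
      using that by (auto simp: color_subgraph_def c_def split: if_splits)
    ultimately show ?thesis using no_alt_path_within_blocks[OF m, of "?G 1"] emb by simp
  next
    case 2
    moreover have "x div m \<noteq> y div m" if "{x, y} \<in> edges (?G 2)" for x y
      using that by (auto simp: color_subgraph_def c_def split: if_splits)
    moreover have "vertices (?G 2) \<subseteq> {..<n}"
      by (simp add: color_subgraph_def complete_graph_def)
    ultimately show ?thesis using no_mon_path_across_blocks[OF n, of "?G 2"] emb by simp
  qed
qed

section \<open>The Ramsey number\<close>

theorem corollary4p2:
  fixes a b :: nat
  assumes "a \<ge> 1" and "b \<ge> 1"
  shows "reflective_ramsey [alt_path a, mon_path b] = 1 + (a - 1) * (b - 1)"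
proof -
  let ?Hs = "[(alt_path a, reflection_group (alt_path a)), (mon_path b, reflection_group (mon_path b))]"
  have "order_of (alt_path a) = a" by (simp add: alt_path_def)
  then have upper: "perm_ramsey_prop ?Hs (1 + (a - 1) * (b - 1))"
    by (intro graph_versus_mon_path_upper simple_graph_alt_path assms) simp
  have lower: "1 + (a - 1) * (b - 1) \<le> n" if n: "n \<ge> 1" "perm_ramsey_prop ?Hs n" for n
  proof (rule ccontr)
    assume "\<not> 1 + (a - 1) * (b - 1) \<le> n"
    then have small: "n \<le> (a - 1) * (b - 1)" by linarith
    \<comment> \<open>As \<open>n\<close> is positive, so is the block size \<open>a - 1\<close>.\<close>
    have "a - 1 \<noteq> 0"
    proof
      assume "a - 1 = 0"
      with small n(1) show False by simp
    qed
    then have "a - 1 > 0" by simp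
    moreover have "Suc (a - 1) = a" "Suc (b - 1) = b" using assms by simp_all
    ultimately show False
      using alt_path_versus_mon_path_lower[OF _ small] n(2) by metis
  qed
  have "(LEAST n. n \<ge> 1 \<and> perm_ramsey_prop ?Hs n) = 1 + (a - 1) * (b - 1)"
    by (rule Least_equality) (use upper lower in auto)
  then show ?thesis by (simp add: reflective_ramsey_def perm_ramsey_def)
qed

end
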